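(* Let $G$ and $H$ be connected bipartite graphs with $G\approx H$. Then $|\mathrm{Hom}(G,T)| = |\mathrm{Hom}(H,T)|$ for every tree $T$ of diameter at most $3$.
   Context: All graphs are finite, simple and undirected. $\mathrm{Hom}(G,H)$ is the set of homomorphisms from $G$ to $H$. A tree is a connected acyclic graph; the diameter is the maximum over pairs of distinct vertices of the length of a shortest path between them. For a vertex set $S$, $N(S)$ is the set of vertices adjacent to some vertex of $S$. Two connected bipartite graphs $G,H$ (with at least two vertices) are neighbourhood size equivalent, $G\approx H$, if there are bipartitions $(X^G,Y^G)$ of $G$ and $(X^H,Y^H)$ of $H$ with $|X^G|\le|Y^G|$, $|X^H|\le|Y^H|$, $|X^G|=|X^H|$, $|Y^G|=|Y^H|$, and a bijection $\eta$ from the power set of $X^G$ to the power set of $X^H$ such that for every $S\subseteq X^G$: $|\eta(S)|=|S|$ and $|N(\eta(S))| = |N(S)|$. *)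

theory Defs
  imports "Graph_Theory.Digraph_Component" "HOL-Library.FuncSet"
begin

text \<open>
  A finite simple undirected graph is a \<open>pair_graph\<close>: a finite vertex set with a symmetric,
  irreflexive set of arcs, in which the undirected edge \<open>uv\<close> is represented by the two arcs
  \<open>(u, v)\<close> and \<open>(v, u)\<close>.
\<close>

definition Hom :: "'a pair_pre_digraph \<Rightarrow> 'b pair_pre_digraph \<Rightarrow> ('a \<Rightarrow> 'b) set" where
  "Hom G H = {f \<in> pverts G \<rightarrow>\<^sub>E pverts H. \<forall>(u, v) \<in> parcs G. (f u, f v) \<in> parcs H}"

definition neighbourhood :: "'a pair_pre_digraph \<Rightarrow> 'a set \<Rightarrow> 'a set" where
  "neighbourhood G S = {v \<in> pverts G. \<exists>u \<in> S. (u, v) \<in> parcs G}"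

definition bipartition :: "'a pair_pre_digraph \<Rightarrow> 'a set \<Rightarrow> 'a set \<Rightarrow> bool" where
  "bipartition G X Y \<longleftrightarrow>
     X \<union> Y = pverts G \<and> X \<inter> Y = {} \<and>
     (\<forall>(u, v) \<in> parcs G. (u \<in> X \<and> v \<in> Y) \<or> (u \<in> Y \<and> v \<in> X))"

definition bipartite :: "'a pair_pre_digraph \<Rightarrow> bool" where
  "bipartite G \<longleftrightarrow> (\<exists>X Y. bipartition G X Y)"

text \<open>
  The library's \<open>tree\<close> and \<open>forest\<close> are not usable for undirected graphs: in a symmetric digraph
  the arcs \<open>(u, v)\<close>, \<open>(v, u)\<close> form a directed cycle of length 2, so any edge would violate
  acyclicity. The cycles of an undirected simple graph are the directed cycles of length
  at least 3. The library's \<open>connected\<close> excludes the graph without vertices.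
\<close>

definition undirected_tree :: "'a pair_pre_digraph \<Rightarrow> bool" where
  "undirected_tree G \<longleftrightarrow>
     Digraph_Component.connected (with_proj G) \<and>
     \<not> (\<exists>p. pre_digraph.cycle (with_proj G) p \<and> 3 \<le> length p)"

text \<open>
  The next two definitions are meaningful for connected graphs only: otherwise some pair of
  vertices is joined by no path and the \<open>LEAST\<close> is unspecified.
\<close>

definition graph_distance :: "'a pair_pre_digraph \<Rightarrow> 'a \<Rightarrow> 'a \<Rightarrow> nat" where
  "graph_distance G u v = (LEAST n. \<exists>p. pre_digraph.apath (with_proj G) u p v \<and> length p = n)"

text \<open>Inserting 0 only serves to give the one-vertex graph diameter 0.\<close>

definition graph_diameter :: "'a pair_pre_digraph \<Rightarrow> nat" where
  "graph_diameter G =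
     Max (insert 0 {graph_distance G u v | u v. u \<in> pverts G \<and> v \<in> pverts G \<and> u \<noteq> v})"

definition neighbourhood_size_equivalent ::
    "'a pair_pre_digraph \<Rightarrow> 'b pair_pre_digraph \<Rightarrow> bool" (infix \<open>\<approx>\<^sub>N\<close> 50) where
  "G \<approx>\<^sub>N H \<longleftrightarrow>
     (\<exists>XG YG XH YH \<eta>.
        bipartition G XG YG \<and> bipartition H XH YH \<and>
        card XG \<le> card YG \<and> card XH \<le> card YH \<and>
        card XG = card XH \<and> card YG = card YH \<and>
        bij_betw \<eta> (Pow XG) (Pow XH) \<and>
        (\<forall>S. S \<subseteq> XG \<longrightarrow>
           card (\<eta> S) = card S \<and>
           card (neighbourhood H (\<eta> S)) = card (neighbourhood G S)))"

end

theory Submission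
  imports Defs
begin

text \<open>
  A tree of diameter at most 3 with at least one edge has an edge \<open>ab\<close> meeting all its edges, for
  otherwise it contains a path on five vertices. Let \<open>P\<close> and \<open>Q\<close> be its two sides, with \<open>a \<in> P\<close> and
  \<open>b \<in> Q\<close>. A homomorphism mapping \<open>X\<close> to \<open>P\<close> and \<open>Y\<close> to \<open>Q\<close> is determined by the
  set \<open>S \<subseteq> X\<close> of vertices not sent to \<open>a\<close>, an arbitrary map \<open>S \<rightarrow> P - {a}\<close>, and an
  arbitrary map \<open>Y - N(S) \<rightarrow> Q\<close>; the vertices of \<open>N(S)\<close> must go to \<open>b\<close>. Hence the number of
  homomorphisms depends only on the multiset of pairs \<open>(|S|, |N(S)|)\<close>.
\<close>

section \<open>Double stars and homomorphisms with prescribed sides\<close>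

text \<open>The vertices of \<open>P - {a}\<close> are leaves at \<open>b\<close> and those of
  \<open>Q - {b}\<close> leaves at \<open>a\<close>; stars and the single edge are degenerate cases.
  Arcs from \<open>Q\<close> to \<open>P\<close> are left to the symmetry of
  \<open>T\<close>.\<close>

definition double_star :: "'a pair_pre_digraph \<Rightarrow> 'a \<Rightarrow> 'a \<Rightarrow> 'a set \<Rightarrow> 'a set \<Rightarrow> bool" where
  "double_star T a b P Q \<longleftrightarrow> bipartition T P Q \<and> a \<in> P \<and> b \<in> Q \<and>
     (\<forall>p\<in>P. \<forall>q\<in>Q. (p, q) \<in> parcs T \<longleftrightarrow> p = a \<or> q = b)"

lemma bipartition_sym: "bipartition G X Y \<Longrightarrow> bipartition G Y X"
  unfolding bipartition_def by blast

lemma (in pair_graph) double_star_sym: "double_star G a b P Q \<Longrightarrow> double_star G b a Q P"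
  unfolding double_star_def using bipartition_sym arcs_symmetric by blast

definition side_homs ::
    "'a pair_pre_digraph \<Rightarrow> 'b pair_pre_digraph \<Rightarrow> 'a set \<Rightarrow> 'a set \<Rightarrow> 'b set \<Rightarrow> 'b set \<Rightarrow> ('a \<Rightarrow> 'b) set"
  where "side_homs G T X Y P Q = {f \<in> Hom G T. f ` X \<subseteq> P \<and> f ` Y \<subseteq> Q}"

section \<open>Counting homomorphisms to a double star\<close>

text \<open>Once \<open>S\<close> is fixed, all arc conditions become conditions on single vertices:
  a vertex of \<open>Y\<close> outside N(S) has all its neighbours sent to \<open>a\<close>, which
  is adjacent to all of \<open>Q\<close>. Hence the fibre is a full product.\<close>

lemma (in pair_graph) side_homs_fibre:
  fixes T :: "'b pair_pre_digraph"
  assumes bip: "bipartition G X Y" and T: "pair_graph T" and ds: "double_star T a b P Q" and S: "S \<subseteq> X"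
  shows "{f \<in> side_homs G T X Y P Q. {x \<in> X. f x \<noteq> a} = S} =
    (\<Pi>\<^sub>E v\<in>X \<union> Y. if v \<in> S then P - {a} else if v \<in> X then {a}
                  else if v \<in> neighbourhood G S then {b} else Q)" (is "?L = ?R")
proof
  interpret T: pair_graph T by (fact T)
  have V: "X \<union> Y = pverts G" and XY: "X \<inter> Y = {}"
    and arcs: "\<And>u v. (u, v) \<in> parcs G \<Longrightarrow> (u \<in> X \<and> v \<in> Y) \<or> (u \<in> Y \<and> v \<in> X)"
    using bip unfolding bipartition_def by auto
  have PQ: "P \<union> Q = pverts T" "a \<in> P" "b \<in> Q"
    and adj: "\<And>p q. p \<in> P \<Longrightarrow> q \<in> Q \<Longrightarrow> (p, q) \<in> parcs T \<longleftrightarrow> p = a \<or> q = b"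
    using ds unfolding double_star_def bipartition_def by auto
  show "?L \<subseteq> ?R"
  proof
    fix f assume "f \<in> ?L"
    then have f: "f \<in> pverts G \<rightarrow>\<^sub>E pverts T" and fX: "\<And>x. x \<in> X \<Longrightarrow> f x \<in> P"
      and fY: "\<And>y. y \<in> Y \<Longrightarrow> f y \<in> Q" and fS: "{x \<in> X. f x \<noteq> a} = S"
      and hom: "\<And>u v. (u, v) \<in> parcs G \<Longrightarrow> (f u, f v) \<in> parcs T"
      unfolding side_homs_def Hom_def by auto
    have "f v = b" if v: "v \<in> neighbourhood G S" "v \<notin> X" for v
    proof -
      obtain u where u: "u \<in> S" "(u, v) \<in> parcs G" using v unfolding neighbourhood_def by blast
      then have "u \<in> X" "f u \<noteq> a" using fS by auto
      moreover have "v \<in> Y" using arcs[OF u(2)] v XY by blast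
      ultimately show ?thesis using adj[of "f u" "f v"] fX fY hom[OF u(2)] by blast
    qed
    moreover have "f v = a" if "v \<in> X" "v \<notin> S" for v using that fS by blast
    moreover have "f v \<in> P - {a}" if "v \<in> S" for v using that fX fS by blast
    moreover have "f \<in> extensional (X \<union> Y)" using f V unfolding PiE_iff by simp
    ultimately show "f \<in> ?R" unfolding PiE_iff using fY by (simp, blast)
  qed
  show "?R \<subseteq> ?L"
  proof
    fix f assume "f \<in> ?R"
    then have ext: "f \<in> extensional (X \<union> Y)" and
      val: "\<And>v. v \<in> X \<union> Y \<Longrightarrow> f v \<in> (if v \<in> S then P - {a} else if v \<in> X then {a}
                  else if v \<in> neighbourhood G S then {b} else Q)"
      unfolding PiE_iff by auto
    have fX: "f x \<in> P" if "x \<in> X" for x using val[of x] that PQ by (auto split: if_splits)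
    have fY: "f y \<in> Q" if "y \<in> Y" for y
    proof -
      have "y \<notin> X" "y \<notin> S" using that XY S by auto
      then show ?thesis using val[of y] that PQ by (auto split: if_splits)
    qed
    have fS: "{x \<in> X. f x \<noteq> a} = S"
    proof (rule set_eqI)
      fix x show "x \<in> {x \<in> X. f x \<noteq> a} \<longleftrightarrow> x \<in> S"
        using val[of x] S by (cases "x \<in> X"; cases "x \<in> S") auto
    qed
    \<comment> \<open>Arcs from \<open>X\<close> to \<open>Y\<close> suffice by symmetry of both
      graphs. If \<open>f u\<close> is not \<open>a\<close>, then \<open>u\<close> lies in
      \<open>S\<close> and \<open>v\<close> is forced to \<open>b\<close>.\<close>
    have *: "(f u, f v) \<in> parcs T" if "(u, v) \<in> parcs G" "u \<in> X" "v \<in> Y" for u v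
    proof (cases "f u = a")
      case True then show ?thesis using adj fX fY that by blast
    next
      case False
      then have "v \<in> neighbourhood G S" "v \<notin> X" "v \<notin> S"
        using that fS XY S V unfolding neighbourhood_def by auto
      then have "f v = b" using val[of v] that by auto
      then show ?thesis using adj fX fY that by blast
    qed
    have "(f u, f v) \<in> parcs T" if "(u, v) \<in> parcs G" for u v
      using arcs[OF that] * that arcs_symmetric T.arcs_symmetric by blast
    moreover have "f v \<in> pverts T" if "v \<in> pverts G" for v using that V PQ fX fY by blast
    ultimately show "f \<in> ?L" using ext fX fY fS V unfolding side_homs_def Hom_def PiE_iff by auto
  qed
qed

text \<open>Sum of the sizes of the product fibres. Both subtractions are exact, as \<open>a\<close>
  lies in \<open>P\<close> and N(S) in \<open>Y\<close>. If \<open>P = {a}\<close>, the convention 0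
  ^ 0 = 1 leaves exactly the term of the empty \<open>S\<close>.\<close>

lemma (in pair_graph) card_side_homs:
  fixes T :: "'b pair_pre_digraph"
  assumes bip: "bipartition G X Y" and T: "pair_graph T" and ds: "double_star T a b P Q"
  shows "card (side_homs G T X Y P Q) =
    (\<Sum>S\<in>Pow X. (card P - 1) ^ card S * card Q ^ (card Y - card (neighbourhood G S)))"
proof -
  interpret T: pair_graph T by (fact T)
  have V: "X \<union> Y = pverts G" and XY: "X \<inter> Y = {}"
    and arcs: "\<And>u v. (u, v) \<in> parcs G \<Longrightarrow> (u \<in> X \<and> v \<in> Y) \<or> (u \<in> Y \<and> v \<in> X)"
    using bip unfolding bipartition_def by auto
  have fin: "finite X" "finite Y" using V pair_finite_verts by (metis finite_Un)+
  have PQ: "P \<union> Q = pverts T" "a \<in> P" using ds unfolding double_star_def bipartition_def by auto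
  have finPQ: "finite P" "finite Q" using PQ T.pair_finite_verts by (metis finite_Un)+
  define F where "F S = {f \<in> side_homs G T X Y P Q. {x \<in> X. f x \<noteq> a} = S}" for S
  define D where "D S v = (if v \<in> S then P - {a} else if v \<in> X then {a}
                  else if v \<in> neighbourhood G S then {b} else Q)" for S v
  have F: "F S = (\<Pi>\<^sub>E v\<in>X \<union> Y. D S v)" if "S \<subseteq> X" for S
    unfolding F_def D_def by (rule side_homs_fibre[OF bip T ds that])
  have finD: "finite (D S v)" for S v unfolding D_def using finPQ by auto
  have "f \<in> F {x \<in> X. f x \<noteq> a} \<and> {x \<in> X. f x \<noteq> a} \<in> Pow X"
    if "f \<in> side_homs G T X Y P Q" for f
    using that unfolding F_def by simp
  moreover have "F S \<subseteq> side_homs G T X Y P Q" for S unfolding F_def by simp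
  ultimately have "side_homs G T X Y P Q = (\<Union>S\<in>Pow X. F S)" by blast
  then have "card (side_homs G T X Y P Q) = card (\<Union>S\<in>Pow X. F S)" by simp
  also have "\<dots> = (\<Sum>S\<in>Pow X. card (F S))"
  proof (rule card_UN_disjoint)
    show "\<forall>S\<in>Pow X. finite (F S)" using F finD fin by (auto intro!: finite_PiE)
    show "\<forall>S\<in>Pow X. \<forall>S'\<in>Pow X. S \<noteq> S' \<longrightarrow> F S \<inter> F S' = {}"
      unfolding F_def disjoint_iff mem_Collect_eq by metis
  qed (use fin in simp)
  also have "\<dots> = (\<Sum>S\<in>Pow X. (card P - 1) ^ card S * card Q ^ (card Y - card (neighbourhood G S)))"
  proof (rule sum.cong[OF refl])
    fix S assume "S \<in> Pow X"
    then have S: "S \<subseteq> X" by simp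
    have N: "neighbourhood G S \<subseteq> Y" unfolding neighbourhood_def using arcs S XY by blast
    have "card (F S) = (\<Prod>v\<in>X \<union> Y. card (D S v))"
      using F[OF S] fin by (simp add: card_PiE)
    also have "\<dots> = (\<Prod>v\<in>X. card (D S v)) * (\<Prod>v\<in>Y. card (D S v))"
      using fin XY by (rule prod.union_disjoint)
    also have "(\<Prod>v\<in>X. card (D S v)) = (\<Prod>v\<in>X. if v \<in> S then card P - 1 else 1)"
      by (rule prod.cong) (use PQ finPQ in \<open>auto simp: D_def\<close>)
    also have "\<dots> = (card P - 1) ^ card S"
      using fin S by (simp add: prod.If_cases Int_absorb1)
    also have "(\<Prod>v\<in>Y. card (D S v)) = (\<Prod>v\<in>Y. if v \<in> neighbourhood G S then 1 else card Q)"
      by (rule prod.cong) (use XY S in \<open>auto simp: D_def\<close>)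
    also have "\<dots> = card Q ^ card (Y - neighbourhood G S)"
      using fin by (simp add: prod.If_cases Diff_eq)
    also have "card (Y - neighbourhood G S) = card Y - card (neighbourhood G S)"
      using N fin by (simp add: card_Diff_subset finite_subset)
    finally show "card (F S) = (card P - 1) ^ card S * card Q ^ (card Y - card (neighbourhood G S))" .
  qed
  finally show ?thesis .
qed

section \<open>Connectedness\<close>

text \<open>\<open>connected\<close> means strong connectedness of the symmetric closure, which here
  is \<open>G\<close> itself.\<close>

lemma (in pair_graph) connected_reachable:
  assumes "Digraph_Component.connected (with_proj G)" "u \<in> pverts G" "v \<in> pverts G"
  shows "reachable (with_proj G) u v"
proof -
  have "mk_symmetric (with_proj G) = G"
    unfolding mk_symmetric_def using arcs_symmetric
    by (intro pair_pre_digraph.equality) auto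
  then show ?thesis
    using assms unfolding Digraph_Component.connected_def strongly_connected_def by simp
qed

text \<open>The form in which connectedness is used below: a property that passes along arcs spreads
  from one vertex to all, or else some arc leaves \<open>C\<close>.\<close>

lemma (in pair_graph) connected_closed:
  assumes "Digraph_Component.connected (with_proj G)" and "u \<in> C" "u \<in> pverts G"
    and closed: "\<And>x y. x \<in> C \<Longrightarrow> (x, y) \<in> parcs G \<Longrightarrow> y \<in> C"
  shows "pverts G \<subseteq> C"
proof
  fix v assume "v \<in> pverts G"
  with assms have "reachable (with_proj G) u v" by (intro connected_reachable)
  then show "v \<in> C"
  proof (induct rule: reachable_induct)
    case base show ?case by (fact assms(2))
  next
    case (step x y) then show ?case using closed by auto
  qed
qed

text \<open>Every arc switches sides in both \<open>G\<close> and \<open>T\<close>, so the choice of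
  sides made at one vertex propagates to all. Nonemptiness of \<open>G\<close> keeps the two classes
  disjoint: the empty map would belong to both.\<close>

lemma (in pair_graph) card_Hom_double_star:
  fixes T :: "'b pair_pre_digraph"
  assumes conn: "Digraph_Component.connected (with_proj G)" and ne: "pverts G \<noteq> {}"
    and bip: "bipartition G X Y" and T: "pair_graph T" and ds: "double_star T a b P Q"
  shows "card (Hom G T) = card (side_homs G T X Y P Q) + card (side_homs G T X Y Q P)"
proof -
  interpret T: pair_graph T by (fact T)
  have V: "X \<union> Y = pverts G" and XY: "X \<inter> Y = {}"
    and arcs: "\<And>u v. (u, v) \<in> parcs G \<Longrightarrow> (u \<in> X \<and> v \<in> Y) \<or> (u \<in> Y \<and> v \<in> X)"
    using bip unfolding bipartition_def by auto
  have PQ: "P \<union> Q = pverts T" "P \<inter> Q = {}"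
    and Tarcs: "\<And>u v. (u, v) \<in> parcs T \<Longrightarrow> (u \<in> P \<and> v \<in> Q) \<or> (u \<in> Q \<and> v \<in> P)"
    using ds unfolding double_star_def bipartition_def by auto
  have finHom: "finite (Hom G T)"
    unfolding Hom_def
    by (rule finite_subset[OF _ finite_PiE[OF pair_finite_verts T.pair_finite_verts]]) auto
  have "f \<in> side_homs G T X Y P Q \<union> side_homs G T X Y Q P" if f: "f \<in> Hom G T" for f
  proof -
    \<comment> \<open>\<open>C\<close> collects the vertices where \<open>f\<close> matches
      \<open>X\<close> with \<open>P\<close> and \<open>Y\<close> with \<open>Q\<close>, and
      \<open>C'\<close> those with the opposite matching. Each is closed under arcs.\<close>
    define C where "C = {x \<in> X. f x \<in> P} \<union> {y \<in> Y. f y \<in> Q}"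
    define C' where "C' = {x \<in> X. f x \<in> Q} \<union> {y \<in> Y. f y \<in> P}"
    have hom: "\<And>u v. (u, v) \<in> parcs G \<Longrightarrow> (f u, f v) \<in> parcs T" using f unfolding Hom_def by auto
    have closed: "y \<in> C" if "x \<in> C" "(x, y) \<in> parcs G" for x y
      using that arcs[OF that(2)] Tarcs[OF hom[OF that(2)]] XY PQ unfolding C_def by blast
    have closed': "y \<in> C'" if "x \<in> C'" "(x, y) \<in> parcs G" for x y
      using that arcs[OF that(2)] Tarcs[OF hom[OF that(2)]] XY PQ unfolding C'_def by blast
    obtain u where u: "u \<in> pverts G" using ne by blast
    have "f u \<in> P \<union> Q" using f u PQ unfolding Hom_def by auto
    then have "u \<in> C \<or> u \<in> C'" using u V unfolding C_def C'_def by blast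
    then have "pverts G \<subseteq> C \<or> pverts G \<subseteq> C'"
      using connected_closed[OF conn _ u] closed closed' by metis
    then show ?thesis
      using f V XY unfolding C_def C'_def side_homs_def by auto
  qed
  then have "Hom G T = side_homs G T X Y P Q \<union> side_homs G T X Y Q P"
    unfolding side_homs_def by blast
  moreover have "side_homs G T X Y P Q \<inter> side_homs G T X Y Q P = {}"
  proof (rule ccontr)
    assume "\<not> ?thesis"
    then obtain f where "f ` X \<subseteq> P" "f ` Y \<subseteq> Q" "f ` X \<subseteq> Q" "f ` Y \<subseteq> P"
      unfolding side_homs_def by auto
    moreover obtain u where "u \<in> X \<union> Y" using ne V by blast
    ultimately have "f u \<in> P \<inter> Q" by blast
    then show False using PQ by simp
  qed
  ultimately show ?thesis using finHom by (simp add: card_Un_disjoint)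
qed

text \<open>Without an arc leaving \<open>u\<close>, the set \<open>{u}\<close> would be closed and
  hence contain all vertices.\<close>

lemma (in pair_graph) connected_arc_exists:
  assumes conn: "Digraph_Component.connected (with_proj G)" and card: "2 \<le> card (pverts G)"
  obtains u v where "(u, v) \<in> parcs G"
proof -
  obtain u where u: "u \<in> pverts G" using card by fastforce
  have "\<not> pverts G \<subseteq> {u}"
    using card card_mono[of "{u}" "pverts G"] by auto
  then show ?thesis using connected_closed[OF conn, of u "{u}"] u that by blast
qed

section \<open>Trees of diameter at most 3\<close>

lemma (in pair_graph) diameter_path:
  assumes conn: "Digraph_Component.connected (with_proj G)" and diam: "graph_diameter G \<le> n"
    and uv: "u \<in> pverts G" "v \<in> pverts G" "u \<noteq> v"
  obtains p where "apath u p v" "length p \<le> n"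
proof -
  let ?D = "{graph_distance G u v | u v. u \<in> pverts G \<and> v \<in> pverts G \<and> u \<noteq> v}"
  have "?D \<subseteq> (\<lambda>(u, v). graph_distance G u v) ` (pverts G \<times> pverts G)" by auto
  then have fin: "finite ?D" by (rule finite_subset) (simp add: pair_finite_verts)
  have "graph_distance G u v \<in> ?D" using uv by blast
  then have le: "graph_distance G u v \<le> n"
    using diam fin unfolding graph_diameter_def by (meson Max_ge finite_insert insertCI le_trans)
  \<comment> \<open>Some path exists, so the \<open>LEAST\<close> in \<open>graph_distance\<close>
    is attained.\<close>
  obtain q where "apath u q v"
    using connected_reachable[OF conn uv(1,2)] reachable_apath by blast
  then have "\<exists>m p. apath u p v \<and> length p = m" by blast
  then have "\<exists>p. apath u p v \<and> length p = graph_distance G u v"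
    unfolding graph_distance_def by (rule LeastI_ex)
  then show thesis using le that by auto
qed

lemma length_le_3_cases:
  assumes "length p \<le> 3"
  obtains "p = []" | e1 where "p = [e1]" | e1 e2 where "p = [e1, e2]" | e1 e2 e3 where "p = [e1, e2, e3]"
proof -
  consider "length p = 0" | "length p = 1" | "length p = 2" | "length p = 3" using assms by linarith
  then show thesis
    by cases (use that in \<open>auto simp: length_Suc_conv numeral_eq_Suc\<close>)
qed

text \<open>Distinctness is recorded only for paths of length 3; for shorter ones it follows from
  \<open>u \<noteq> v\<close> and the absence of loops.\<close>

lemma (in pair_graph) diameter_3_cases:
  assumes conn: "Digraph_Component.connected (with_proj G)" and diam: "graph_diameter G \<le> 3"
    and uv: "u \<in> pverts G" "v \<in> pverts G" "u \<noteq> v"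
  obtains "(u, v) \<in> parcs G" | x where "(u, x) \<in> parcs G" "(x, v) \<in> parcs G"
    | x y where "(u, x) \<in> parcs G" "(x, y) \<in> parcs G" "(y, v) \<in> parcs G" "distinct [u, x, y, v]"
proof -
  obtain p where p: "apath u p v" "length p \<le> 3" using diameter_path[OF conn diam uv] .
  from p(2) show thesis
  proof (cases rule: length_le_3_cases)
    case 1 then show thesis using p uv by (auto simp: apath_def awalk_def)
  next
    case (2 e1) then show thesis using p that(1) by (cases e1) (auto simp: apath_def awalk_def)
  next
    case (3 e1 e2) then show thesis using p that(2)
      by (cases e1; cases e2) (auto simp: apath_def awalk_def)
  next
    case (4 e1 e2 e3) then show thesis using p that(3)
      by (cases e1; cases e2; cases e3) (auto simp: apath_def awalk_def)
  qed
qed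

text \<open>Zipping with the rotated list gives the consecutive arcs together with the closing one,
  so concrete vertex lists can be refuted by simplification.\<close>

lemma (in pair_graph) undirected_tree_no_cycle:
  assumes "undirected_tree G" and "distinct vs" and "3 \<le> length vs"
  shows "\<not> set (zip vs (rotate1 vs)) \<subseteq> parcs G"
proof
  assume sub: "set (zip vs (rotate1 vs)) \<subseteq> parcs G"
  obtain x xs where vs: "vs = x # xs" using assms(3) by (cases vs) auto
  \<comment> \<open>The induction moves the start \<open>y\<close> and keeps the end
    \<open>z\<close> fixed; setting both to \<open>x\<close> afterwards closes the walk.\<close>
  have pc: "pcas y (zip (y # ys) (ys @ [z])) z" for y ys z
    by (induct ys arbitrary: y) auto
  have pv: "pawalk_verts y (zip (y # ys) (ys @ [z])) = y # ys @ [z]" for y ys z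
    by (induct ys arbitrary: y) auto
  let ?p = "zip vs (rotate1 vs)"
  have "(x, hd (xs @ [x])) \<in> parcs G" using sub vs by (cases xs) auto
  then have "x \<in> pverts G" by (rule in_arcsD1)
  then have "cycle ?p"
    unfolding cycle_def awalk_def using sub assms(2) pc[of x xs x] pv[of x xs x]
    by (intro exI[of _ x]) (auto simp: vs)
  then show False using assms unfolding undirected_tree_def by auto
qed

text \<open>The ends \<open>w\<close> and \<open>v\<close> are also joined by a path of length at
  most 3, and the two paths together contain a cycle. The instances of \<open>nc\<close> cover the
  possible coincidences of inner vertices.\<close>

lemma (in pair_graph) tree_diameter_3_no_path5:
  assumes tree: "undirected_tree G" and diam: "graph_diameter G \<le> 3"
    and arcs: "(w, c) \<in> parcs G" "(c, a) \<in> parcs G" "(a, b) \<in> parcs G" "(b, v) \<in> parcs G"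
    and dist: "distinct [w, c, a, b, v]"
  shows False
proof -
  note nc = undirected_tree_no_cycle[OF tree]
  have conn: "Digraph_Component.connected (with_proj G)"
    using tree unfolding undirected_tree_def by simp
  have arcs': "(c, w) \<in> parcs G" "(a, c) \<in> parcs G" "(b, a) \<in> parcs G" "(v, b) \<in> parcs G"
    using arcs arcs_symmetric by blast+
  have V: "w \<in> pverts G" "v \<in> pverts G" "w \<noteq> v" using arcs dist wellformed' by auto
  show False
  proof (cases rule: diameter_3_cases[OF conn diam V])
    case 1
    then show False using nc[of "[w, c, a, b, v]"] arcs arcs' dist arcs_symmetric[OF 1] by auto
  next
    \<comment> \<open>A new \<open>x\<close> gives a six-cycle; \<open>x\<close> equal to
      \<open>c\<close>, \<open>a\<close> or \<open>b\<close> gives a chord that closes a shorter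
      cycle.\<close>
    case (2 x)
    then have "(x, w) \<in> parcs G" "(v, x) \<in> parcs G" "x \<noteq> w" "x \<noteq> v"
      using arcs_symmetric no_loops' by auto
    then show False
      using 2 arcs arcs' dist nc[of "[w, c, a, b, v, x]"] nc[of "[c, a, b, v]"] nc[of "[a, b, v]"]
        nc[of "[w, c, a]"] nc[of "[w, c, a, b]"]
      by auto
  next
    case (3 x y)
    then have "(x, w) \<in> parcs G" "(y, x) \<in> parcs G" "(v, y) \<in> parcs G" using arcs_symmetric by auto
    then show False
      using 3 arcs arcs' dist nc[of "[w, c, a, b, v, y, x]"] nc[of "[c, a, b, v]"] nc[of "[a, b, v]"]
        nc[of "[w, c, a]"] nc[of "[w, c, a, b]"] nc[of "[c, a, b]"]
        nc[of "[w, c, a, b, x]"] nc[of "[c, a, b, v, y]"]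
      by auto
  qed
qed

text \<open>The middle arc of a path on four vertices dominates, since otherwise a path on five
  vertices arises. If there is no path on four vertices, any arc dominates.\<close>

lemma (in pair_graph) tree_diameter_3_dominating_arc:
  assumes tree: "undirected_tree G" and diam: "graph_diameter G \<le> 3" and arc: "(r, s) \<in> parcs G"
  obtains a b where "(a, b) \<in> parcs G"
    and "\<And>w. w \<in> pverts G \<Longrightarrow> (a, w) \<in> parcs G \<or> (b, w) \<in> parcs G"
proof -
  note nc = undirected_tree_no_cycle[OF tree]
  have conn: "Digraph_Component.connected (with_proj G)"
    using tree unfolding undirected_tree_def by simp
  \<comment> \<open>The set of vertices adjacent to \<open>a\<close> or \<open>b\<close> contains
    \<open>b\<close>. If it misses some vertex, an arc leaves it, which gives an undominated vertex
    next to a dominated one.\<close>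
  have escape: "\<exists>c w. (c, w) \<in> parcs G \<and> ((a, c) \<in> parcs G \<or> (b, c) \<in> parcs G) \<and>
      (a, w) \<notin> parcs G \<and> (b, w) \<notin> parcs G"
    if ab: "(a, b) \<in> parcs G" and w: "w \<in> pverts G" "(a, w) \<notin> parcs G" "(b, w) \<notin> parcs G" for a b w
    using connected_closed[OF conn, of b "{c. (a, c) \<in> parcs G \<or> (b, c) \<in> parcs G}"]
      in_arcsD2[OF ab] ab w by blast
  show thesis
  proof (cases "\<exists>u a b v. (u, a) \<in> parcs G \<and> (a, b) \<in> parcs G \<and> (b, v) \<in> parcs G \<and> distinct [u, a, b, v]")
    case True
    then obtain u a b v where P: "(u, a) \<in> parcs G" "(a, b) \<in> parcs G" "(b, v) \<in> parcs G"
      and d: "distinct [u, a, b, v]" by blast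
    have P': "(a, u) \<in> parcs G" "(b, a) \<in> parcs G" "(v, b) \<in> parcs G" using P arcs_symmetric by auto
    have "(a, w) \<in> parcs G \<or> (b, w) \<in> parcs G" if w: "w \<in> pverts G" for w
    proof (rule ccontr)
      assume "\<not> ?thesis"
      then obtain c w where cw: "(c, w) \<in> parcs G" "(a, w) \<notin> parcs G" "(b, w) \<notin> parcs G"
        and c: "(a, c) \<in> parcs G \<or> (b, c) \<in> parcs G" using escape[OF P(2) w] by blast
      have cw': "(w, c) \<in> parcs G" "c \<noteq> w" "c \<noteq> a" "c \<noteq> b" "w \<noteq> a" "w \<noteq> b" "w \<noteq> u" "w \<noteq> v"
        using cw P P' arcs_symmetric no_loops' by auto
      \<comment> \<open>The forbidden path is w, c, a, b, v or w, c, b, a, u; the absence of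
        triangles keeps \<open>c\<close> off its far end.\<close>
      from c show False
      proof
        assume ac: "(a, c) \<in> parcs G"
        then have ca: "(c, a) \<in> parcs G" by (rule arcs_symmetric)
        then have "c \<noteq> v" using nc[of "[a, b, v]"] P d by auto
        then show False
          using tree_diameter_3_no_path5[OF tree diam cw'(1) ca P(2,3)] cw' d by auto
      next
        assume bc: "(b, c) \<in> parcs G"
        then have cb: "(c, b) \<in> parcs G" by (rule arcs_symmetric)
        then have "c \<noteq> u" using nc[of "[u, a, b]"] P bc d by auto
        then show False
          using tree_diameter_3_no_path5[OF tree diam cw'(1) cb P'(2,1)] cw' d by auto
      qed
    qed
    then show thesis using that P(2) by blast
  next
    case False
    \<comment> \<open>An undominated vertex would give a path w, c, r, s or w, c, s, r, contrary to
      the case assumption.\<close>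
    have "(r, w) \<in> parcs G \<or> (s, w) \<in> parcs G" if w: "w \<in> pverts G" for w
    proof (rule ccontr)
      assume "\<not> ?thesis"
      then obtain c w where cw: "(c, w) \<in> parcs G" "(r, w) \<notin> parcs G" "(s, w) \<notin> parcs G"
        and c: "(r, c) \<in> parcs G \<or> (s, c) \<in> parcs G" using escape[OF arc w] by blast
      have "(w, c) \<in> parcs G" "(s, r) \<in> parcs G" "distinct [w, c, r, s]"
        "(c, r) \<in> parcs G \<or> (c, s) \<in> parcs G"
        using cw c arc arcs_symmetric no_loops' by auto
      then show False using False[simplified] arc by auto
    qed
    then show thesis using that arc by blast
  qed
qed

text \<open>The sides are the neighbourhoods of \<open>b\<close> and \<open>a\<close>. An overlap or
  an arc within a side closes a triangle, and an arc between the sides avoiding both centres closes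
  the four-cycle a, b, p, q.\<close>

lemma (in pair_graph) tree_diameter_3_double_star:
  assumes tree: "undirected_tree G" and diam: "graph_diameter G \<le> 3" and arc: "(r, s) \<in> parcs G"
  obtains a b P Q where "double_star G a b P Q"
proof -
  note nc = undirected_tree_no_cycle[OF tree]
  obtain a b where ab: "(a, b) \<in> parcs G"
    and dom: "\<And>w. w \<in> pverts G \<Longrightarrow> (a, w) \<in> parcs G \<or> (b, w) \<in> parcs G"
    using tree_diameter_3_dominating_arc[OF assms] by blast
  note ba = arcs_symmetric[OF ab]
  define P where "P = {v. (b, v) \<in> parcs G}"
  define Q where "Q = {v. (a, v) \<in> parcs G}"
  have no_tri: False if "(x, y) \<in> parcs G" "(y, z) \<in> parcs G" "(z, x) \<in> parcs G" for x y z
    using nc[of "[x, y, z]"] that no_loops' by auto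
  have PP: False if "x \<in> P" "y \<in> P" "(x, y) \<in> parcs G" for x y
    using no_tri that arcs_symmetric unfolding P_def by blast
  have QQ: False if "x \<in> Q" "y \<in> Q" "(x, y) \<in> parcs G" for x y
    using no_tri that arcs_symmetric unfolding Q_def by blast
  have PQ: "P \<inter> Q = {}" using no_tri ab arcs_symmetric unfolding P_def Q_def by blast
  have V: "P \<union> Q = pverts G" using dom in_arcsD2 unfolding P_def Q_def by blast
  have "bipartition G P Q"
    unfolding bipartition_def using PQ V PP QQ wellformed' by blast
  moreover have "(p, q) \<in> parcs G \<longleftrightarrow> p = a \<or> q = b" if "p \<in> P" "q \<in> Q" for p q
  proof
    assume pq: "(p, q) \<in> parcs G"
    show "p = a \<or> q = b"
    proof (rule ccontr)
      assume "\<not> ?thesis"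
      then have "distinct [a, b, p, q]" using that no_loops' ab pq unfolding P_def Q_def by auto
      then show False
        using nc[of "[a, b, p, q]"] ab pq that arcs_symmetric unfolding P_def Q_def by auto
    qed
  next
    assume "p = a \<or> q = b"
    then show "(p, q) \<in> parcs G" using that arcs_symmetric unfolding P_def Q_def by auto
  qed
  moreover have "a \<in> P" "b \<in> Q" using ab ba unfolding P_def Q_def by simp_all
  ultimately have "double_star G a b P Q"
    unfolding double_star_def by blast
  then show thesis by (rule that)
qed

section \<open>Comparison of the two counts\<close>

theorem theorem12:
  fixes G :: "'a pair_pre_digraph" and H :: "'b pair_pre_digraph" and T :: "'c pair_pre_digraph"
  assumes "pair_graph G" and "Digraph_Component.connected (with_proj G)" and "bipartite G"
    and "2 \<le> card (pverts G)"
    and "pair_graph H" and "Digraph_Component.connected (with_proj H)" and "bipartite H"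
    and "2 \<le> card (pverts H)"
    and "G \<approx>\<^sub>N H"
    and "pair_graph T" and "undirected_tree T" and "graph_diameter T \<le> 3"
  shows "card (Hom G T) = card (Hom H T)"
proof (cases "parcs T = {}")
  \<comment> \<open>Here \<open>T\<close> has no edge to serve as centre, but \<open>G\<close> and
    \<open>H\<close> have arcs, so neither admits a homomorphism.\<close>
  case True
  obtain u v where "(u, v) \<in> parcs G" using pair_graph.connected_arc_exists assms(1,2,4) by blast
  moreover obtain u' v' where "(u', v') \<in> parcs H"
    using pair_graph.connected_arc_exists assms(5,6,8) by blast
  ultimately have "Hom G T = {}" "Hom H T = {}" using True unfolding Hom_def by auto
  then show ?thesis by simp
next
  case False
  then obtain r s where "(r, s) \<in> parcs T" by auto
  then obtain a b P Q where ds: "double_star T a b P Q"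
    using pair_graph.tree_diameter_3_double_star[OF assms(10-12)] by blast
  note ds' = pair_graph.double_star_sym[OF assms(10) ds]
  obtain XG YG XH YH \<eta> where G: "bipartition G XG YG" and H: "bipartition H XH YH"
    and Y: "card YG = card YH" and \<eta>: "bij_betw \<eta> (Pow XG) (Pow XH)"
    and N: "\<And>S. S \<subseteq> XG \<Longrightarrow> card (\<eta> S) = card S \<and>
           card (neighbourhood H (\<eta> S)) = card (neighbourhood G S)"
    using assms(9) unfolding neighbourhood_size_equivalent_def by blast
  \<comment> \<open>Each term depends only on |S| and |N(S)|, which \<open>\<eta>\<close> preserves.
    The numbers \<open>m\<close> and \<open>n\<close> are kept general to serve \<open>P\<close>,
    \<open>Q\<close> in either order.\<close>
  have reindex: "(\<Sum>S\<in>Pow XG. (m - 1) ^ card S * n ^ (card YG - card (neighbourhood G S))) =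
      (\<Sum>S\<in>Pow XH. (m - 1) ^ card S * n ^ (card YH - card (neighbourhood H S)))" for m n :: nat
    unfolding sum.reindex_bij_betw[OF \<eta>, symmetric] using N Y by (intro sum.cong) auto
  have ne: "pverts G \<noteq> {}" "pverts H \<noteq> {}" using assms(4,8) by auto
  show ?thesis
    unfolding pair_graph.card_Hom_double_star[OF assms(1,2) ne(1) G assms(10) ds]
      pair_graph.card_Hom_double_star[OF assms(5,6) ne(2) H assms(10) ds]
      pair_graph.card_side_homs[OF assms(1) G assms(10) ds]
      pair_graph.card_side_homs[OF assms(1) G assms(10) ds']
      pair_graph.card_side_homs[OF assms(5) H assms(10) ds]
      pair_graph.card_side_homs[OF assms(5) H assms(10) ds'] reindex ..
qed

end
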